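(* Let $(\mu_n)$ be a sequence in $(0,1)$ such that $\mu_n\log(\mu_n n)\to 0$ and $\mu_n n\to\infty$ as $n\to\infty$, and choose the scaling $a_n=1/\mu_n$. Then the stationary distribution of the $\textsc{derow-row}(\mu_n)$ process on $\mathcal{P}_n$ has, under the scaling $a_n$, the limit shape $$y(x)=e^{-x}.$$
   Context: $\mathcal{P}_n$ is the set of integer partitions $\lambda=(\lambda_1\ge\lambda_2\ge\dotsb\ge\lambda_N)$ of $n$ (with $N=N(\lambda)$ parts, all positive), identified with Young diagrams whose $i$th row (from the bottom) has length $\lambda_i$. Fix $0<\mu<1$. Down rule $\textsc{derow}$: from a partition $\lambda$, choose one of its $N(\lambda)$ rows uniformly at random, let $\kappa$ be its length, and replace one part of size $\kappa$ by a part of size $\kappa-1$ (deleting it if $\kappa=1$). Up rule $\textsc{row}(\mu)$: from a partition $\lambda$, with probability $\mu$ add a new part of size $1$. Otherwise (with probability $1-\mu$) choose one of the $N(\lambda)$ rows uniformly at random, let $\kappa$ be its length, and replace one part of size $\kappa$ by a part of size $\kappa+1$. For $n\ge2$, the process $\textsc{derow-row}(\mu)$ on $\mathcal{P}_n$ is the up-and-down process that alternately applies $\textsc{derow}$ (moving from $\mathcal{P}_n$ to $\mathcal{P}_{n-1}$) and $\textsc{row}(\mu)$ (moving back to $\mathcal{P}_n$). Its stationary distribution on $\mathcal{P}_n$ is the stationary distribution $\pi_n$ of the Markov chain on $\mathcal{P}_n$ in which each step consists of $\textsc{derow}$ followed by $\textsc{row}(\mu)$. Scaling and limit shape: a diagram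 $\lambda\in\mathcal{P}_n$ is rescaled with scaling factor $a_n>0$ by multiplying all row lengths by $1/a_n$ and all column heights by $a_n/n$ (so the area becomes $1$). Its rescaled boundary function is thus $y_\lambda(x)=\frac{a_n}{n}\,\#\{i:\lambda_i>a_n x\}$ for $x\ge0$. The distributions $\pi_n$ on $\mathcal{P}_n$ have limit shape $y$ under the scaling $a_n$ if for every $x>0$ and every $\varepsilon>0$, $\lim_{n\to\infty}\pi_n\{\lambda\in\mathcal{P}_n:|y_\lambda(x)-y(x)|<\varepsilon\}=1$. *)

theory Defs
  imports "HOL-Probability.Probability"
begin

text \<open>
  An integer partition of \<open>n\<close> is the multiset of its (positive) parts, that is, of the
  row lengths of its Young diagram.
\<close>

definition partitions :: "nat \<Rightarrow> nat multiset set" where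
  "partitions n = {lam. 0 \<notin># lam \<and> sum_mset lam = n}"

text \<open>
  Drawing from \<open>pmf_of_multiset lam\<close> gives the length of a uniformly chosen row, rows of
  equal length being counted with multiplicity. It is meaningful only for nonempty \<open>lam\<close>;
  the empty partition never occurs below when \<open>n \<ge> 2\<close>.
\<close>

definition derow :: "nat multiset \<Rightarrow> nat multiset pmf" where
  "derow lam = map_pmf
     (\<lambda>k. if k = 1 then lam - {#k#} else add_mset (k - 1) (lam - {#k#}))
     (pmf_of_multiset lam)"

definition row_up :: "real \<Rightarrow> nat multiset \<Rightarrow> nat multiset pmf" where
  "row_up \<mu> lam = bind_pmf (bernoulli_pmf \<mu>)
     (\<lambda>new. if new then return_pmf (add_mset 1 lam)
            else map_pmf (\<lambda>k. add_mset (k + 1) (lam - {#k#})) (pmf_of_multiset lam))"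

definition derow_row :: "real \<Rightarrow> nat multiset \<Rightarrow> nat multiset pmf" where
  "derow_row \<mu> lam = bind_pmf (derow lam) (row_up \<mu>)"

definition is_stationary :: "'a set \<Rightarrow> ('a \<Rightarrow> 'a pmf) \<Rightarrow> 'a pmf \<Rightarrow> bool" where
  "is_stationary S K p \<longleftrightarrow> set_pmf p \<subseteq> S \<and> bind_pmf p K = p"

text \<open>
  For \<open>n \<ge> 2\<close> and \<open>0 < \<mu> < 1\<close> the chain maps the finite set \<open>partitions n\<close> to itself and
  is irreducible there, so the description below is uniquely satisfied.
\<close>

definition derow_row_stationary :: "nat \<Rightarrow> real \<Rightarrow> nat multiset pmf" where
  "derow_row_stationary n \<mu> = (THE p. is_stationary (partitions n) (derow_row \<mu>) p)"

definition rescaled_boundary :: "nat \<Rightarrow> real \<Rightarrow> nat multiset \<Rightarrow> real \<Rightarrow> real" where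
  "rescaled_boundary n a lam x = a / real n * real (size {#k \<in># lam. real k > a * x#})"

definition has_limit_shape ::
    "(nat \<Rightarrow> nat multiset pmf) \<Rightarrow> (nat \<Rightarrow> real) \<Rightarrow> (real \<Rightarrow> real) \<Rightarrow> bool" where
  "has_limit_shape \<pi> a y \<longleftrightarrow>
     (\<forall>x>0. \<forall>\<epsilon>>0.
        (\<lambda>n. measure_pmf.prob (\<pi> n)
               {lam \<in> partitions n. \<bar>rescaled_boundary n (a n) lam x - y x\<bar> < \<epsilon>})
        \<longlonglongrightarrow> 1)"

end

theory Submission
  imports Defs "HOL-Combinatorics.Multiset_Permutations" "HOL-Real_Asymp.Real_Asymp"
begin

text \<open>
  The stationary law is known exactly. Cut the interval of length \<open>n\<close> at each of its
  \<open>n - 1\<close> interior integer points independently with probability \<open>\<mu>\<close> and forget the order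
  of the pieces. A partition with \<open>N\<close> parts then has probability
  \<open>\<mu> ^ (N - 1) * (1 - \<mu>) ^ (n - N)\<close> times the number of orderings of its parts; this is
  \<open>partition_law\<close>. Shortening a uniformly chosen piece maps the law for
  \<open>n + 1\<close> to the law for \<open>n\<close>, and the up rule maps it back (\<open>derow_partition_law\<close>,
  \<open>row_up_partition_law\<close>), so the law is stationary. From every partition the chain can reach
  the partition into ones, which forces uniqueness (\<open>stationary_unique\<close>).

  Every computation rests on one double counting, \<open>sum_marked_part\<close>: an arrangement of the
  parts of a partition of \<open>n\<close> with one marked part \<open>k\<close> is an arrangement of a partition of
  \<open>n - k\<close> together with one of the places where \<open>k\<close> can be inserted. Shrinking the marked part
  by \<open>m\<close> shows that the number \<open>X\<close> of parts above \<open>m\<close> satisfies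
  \<open>E X = (1 - \<mu>) ^ m * E N\<close>, where \<open>N\<close> is the number of parts for \<open>n - m\<close>, and in the
  same way \<open>E (X * (X - 1)) = (1 - \<mu>) ^ (2 * m) * E (N * (N - 1))\<close> with \<open>N\<close> taken for
  \<open>n - 2 * m\<close>. Since \<open>N - 1\<close> is binomial, both are explicit.

  The rescaled boundary at \<open>x\<close> is \<open>X / (\<mu> * n)\<close> with \<open>m\<close> the integer part of \<open>x / \<mu>\<close>.
  The hypotheses force \<open>\<mu> \<rightarrow> 0\<close>, hence \<open>(1 - \<mu>) ^ m \<rightarrow> exp (- x)\<close>, and because
  \<open>\<mu> * n \<rightarrow> \<infinity>\<close> the first two moments of the rescaled boundary tend to \<open>exp (- x)\<close> and its
  square. The mean square deviation from \<open>exp (- x)\<close> therefore vanishes, and Markov's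
  inequality gives convergence in probability.
\<close>

section \<open>Partitions as multisets\<close>

lemma size_le_of_partition: "lam \<in> partitions n \<Longrightarrow> size lam \<le> n"
proof -
  assume lam: "lam \<in> partitions n"
  have "size lam \<le> sum_mset lam" if "0 \<notin># lam"
    using that by (induction lam) auto
  then show ?thesis using lam by (simp add: partitions_def)
qed

lemma finite_partitions: "finite (partitions n)"
proof (rule finite_subset)
  show "partitions n \<subseteq> mset ` {xs. set xs \<subseteq> {..n} \<and> length xs \<le> n}"
  proof
    fix lam assume lam: "lam \<in> partitions n"
    obtain xs where xs: "lam = mset xs" using ex_mset by metis
    have "set xs \<subseteq> {..n}"
    proof
      fix k assume "k \<in> set xs"
      then have "k \<in># lam" by (simp add: xs)
      then have "k \<le> sum_mset lam" by (auto dest!: multi_member_split)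
      then show "k \<in> {..n}" using lam by (simp add: partitions_def)
    qed
    moreover have "length xs \<le> n" using size_le_of_partition[OF lam] xs by simp
    ultimately show "lam \<in> mset ` {xs. set xs \<subseteq> {..n} \<and> length xs \<le> n}" using xs by blast
  qed
  show "finite (mset ` {xs. set xs \<subseteq> {..n} \<and> length xs \<le> n})"
    by (intro finite_imageI finite_lists_length_le) simp
qed

lemma part_bounds:
  assumes "lam \<in> partitions n" "k \<in># lam"
  shows "1 \<le> k" "k \<le> n" "lam - {#k#} \<in> partitions (n - k)"
proof -
  obtain rho where rho: "lam = add_mset k rho" using assms multi_member_split by metis
  show "1 \<le> k" "k \<le> n" "lam - {#k#} \<in> partitions (n - k)"
    using assms rho by (auto simp: partitions_def)
qed

lemma add_part: "1 \<le> k \<Longrightarrow> k \<le> n \<Longrightarrow> rho \<in> partitions (n - k) \<Longrightarrow> add_mset k rho \<in> partitions n"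
  by (auto simp: partitions_def)

lemma partition_nonempty: "lam \<in> partitions n \<Longrightarrow> 1 \<le> n \<Longrightarrow> lam \<noteq> {#}"
  by (auto simp: partitions_def)

lemma size_bounds:
  assumes "lam \<in> partitions n" "1 \<le> n"
  shows "1 \<le> size lam" "size lam \<le> n"
  using assms size_le_of_partition partition_nonempty[OF assms]
  by (auto simp: Suc_le_eq nonempty_has_size)

definition arrangements :: "nat multiset \<Rightarrow> real" where
  "arrangements lam = real (card (permutations_of_multiset lam))"

lemma arrangements_empty [simp]: "arrangements {#} = 1"
  by (simp add: arrangements_def)

lemma arrangements_nonneg: "0 \<le> arrangements lam"
  by (simp add: arrangements_def)

lemma arrangements_remove:
  "k \<in># lam \<Longrightarrow> arrangements lam * real (count lam k) = real (size lam) * arrangements (lam - {#k#})"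
  using card_permutations_of_multiset_remove_aux[of k lam]
  unfolding arrangements_def by (metis of_nat_mult)

text \<open>
  A sum over all parts with multiplicity, where the summand sees the marked part and the
  remaining multiset. Divided by the number of parts, it is the mean over a uniformly chosen row.
\<close>

definition part_sum :: "(nat \<Rightarrow> nat multiset \<Rightarrow> real) \<Rightarrow> nat multiset \<Rightarrow> real" where
  "part_sum f lam = (\<Sum>k\<in>set_mset lam. real (count lam k) * f k (lam - {#k#}))"

lemma part_sum_cong:
  "(\<And>k. k \<in># lam \<Longrightarrow> f k (lam - {#k#}) = g k (lam - {#k#})) \<Longrightarrow> part_sum f lam = part_sum g lam"
  unfolding part_sum_def by (rule sum.cong) auto

lemma part_sum_const: "part_sum (\<lambda>_ _. c) lam = real (size lam) * c"
  unfolding part_sum_def by (simp add: size_multiset_overloaded_eq sum_distrib_right)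

text \<open>
  Marking a part turns a pair of a partition and one of its parts into a pair of a part \<open>k\<close> and
  a partition of \<open>n - k\<close>. By \<open>arrangements_remove\<close>, the multiplicity of \<open>k\<close> is absorbed by
  the number of ways to insert \<open>k\<close> into an arrangement of the remaining parts.
\<close>

lemma sum_marked_part:
  "(\<Sum>lam\<in>partitions n. arrangements lam * part_sum f lam)
   = (\<Sum>k=1..n. \<Sum>rho\<in>partitions (n - k). real (size rho + 1) * arrangements rho * f k rho)"
proof -
  have "(\<Sum>lam\<in>partitions n. arrangements lam * part_sum f lam)
      = (\<Sum>lam\<in>partitions n. \<Sum>k\<in>set_mset lam.
           real (size lam) * arrangements (lam - {#k#}) * f k (lam - {#k#}))"
    unfolding part_sum_def sum_distrib_left
    by (intro sum.cong refl) (simp add: arrangements_remove flip: mult.assoc)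
  also have "\<dots> = (\<Sum>(lam, k)\<in>Sigma (partitions n) set_mset.
           real (size lam) * arrangements (lam - {#k#}) * f k (lam - {#k#}))"
    by (rule sum.Sigma) (auto simp: finite_partitions)
  also have "\<dots> = (\<Sum>(k, rho)\<in>Sigma {1..n} (\<lambda>k. partitions (n - k)).
           real (size rho + 1) * arrangements rho * f k rho)"
  proof (rule sum.reindex_bij_witness[where i = "\<lambda>(k, rho). (add_mset k rho, k)"
          and j = "\<lambda>(lam, k). (k, lam - {#k#})"], goal_cases)
    case (2 x)
    then show ?case using part_bounds by auto
  next
    case (4 x)
    then show ?case using add_part by auto
  next
    case (5 x)
    then show ?case using size_Suc_Diff1 by fastforce
  qed auto
  also have "\<dots> = (\<Sum>k=1..n. \<Sum>rho\<in>partitions (n - k).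
           real (size rho + 1) * arrangements rho * f k rho)"
    by (rule sum.Sigma[symmetric]) (auto simp: finite_partitions)
  finally show ?thesis .
qed

text \<open>
  Normalised by the number of parts, marking loses the factor that counts the places of insertion: a
  uniformly chosen part of a composition and the rest of it are distributed like its first part
  and the rest.
\<close>

lemma sum_first_part:
  assumes "1 \<le> n"
  shows "(\<Sum>lam\<in>partitions n. arrangements lam * part_sum f lam / size lam)
   = (\<Sum>k=1..n. \<Sum>rho\<in>partitions (n - k). arrangements rho * f k rho)"
proof -
  have "(\<Sum>lam\<in>partitions n. arrangements lam * part_sum f lam / size lam)
     = (\<Sum>lam\<in>partitions n. arrangements lam * part_sum (\<lambda>k rho. f k rho / (size rho + 1)) lam)"
  proof (intro sum.cong refl)
    fix lam
    have "part_sum (\<lambda>k rho. f k rho / (size rho + 1)) lam = part_sum f lam / size lam"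
      unfolding part_sum_def sum_divide_distrib
    proof (intro sum.cong refl)
      fix k assume "k \<in># lam"
      then have "real (size (lam - {#k#}) + 1) = real (size lam)"
        by (metis Suc_eq_plus1 size_Suc_Diff1)
      then show "real (count lam k) * (f k (lam - {#k#}) / real (size (lam - {#k#}) + 1))
          = real (count lam k) * f k (lam - {#k#}) / real (size lam)" by simp
    qed
    then show "arrangements lam * part_sum f lam / size lam
        = arrangements lam * part_sum (\<lambda>k rho. f k rho / (size rho + 1)) lam" by simp
  qed
  also have "\<dots> = (\<Sum>k=1..n. \<Sum>rho\<in>partitions (n - k). arrangements rho * f k rho)"
    unfolding sum_marked_part by (intro sum.cong refl) simp
  finally show ?thesis .
qed

text \<open>
  Shrinking a marked part above \<open>m\<close> by \<open>m\<close> is a bijection onto the marked partitions of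
  \<open>n - m\<close>, and it leaves the other parts alone. For \<open>m > n\<close> both sides vanish.
\<close>

lemma sum_large_parts:
  "(\<Sum>lam\<in>partitions n. arrangements lam * part_sum (\<lambda>k rho. if k > m then f rho else 0) lam)
   = (\<Sum>lam\<in>partitions (n - m). arrangements lam * part_sum (\<lambda>_. f) lam)"
proof -
  have "(\<Sum>k=1..n. \<Sum>rho\<in>partitions (n - k).
           real (size rho + 1) * arrangements rho * (if k > m then f rho else 0))
      = (\<Sum>k\<in>{m+1..n}. \<Sum>rho\<in>partitions (n - k).
           real (size rho + 1) * arrangements rho * (if k > m then f rho else 0))"
    by (rule sum.mono_neutral_right) (auto intro!: sum.neutral)
  also have "\<dots> = (\<Sum>j=1..n-m. \<Sum>rho\<in>partitions (n - m - j).
           real (size rho + 1) * arrangements rho * f rho)"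
    by (rule sum.reindex_bij_witness[where i = "\<lambda>j. j + m" and j = "\<lambda>k. k - m"]) auto
  finally show ?thesis unfolding sum_marked_part .
qed

text \<open>
  The decomposition of a composition into its first part and the rest, at the level of multisets.
\<close>

lemma sum_peel_part:
  assumes "1 \<le> n"
  shows "(\<Sum>k=1..n. \<Sum>rho\<in>partitions (n - k). arrangements rho * F (add_mset k rho))
       = (\<Sum>lam\<in>partitions n. arrangements lam * F lam)"
proof -
  have "(\<Sum>lam\<in>partitions n. arrangements lam * F lam)
     = (\<Sum>lam\<in>partitions n. arrangements lam * part_sum (\<lambda>k rho. F (add_mset k rho)) lam / size lam)"
  proof (intro sum.cong refl)
    fix lam assume "lam \<in> partitions n"
    then have "lam \<noteq> {#}" using assms partition_nonempty by blast
    moreover have "part_sum (\<lambda>k rho. F (add_mset k rho)) lam = part_sum (\<lambda>_ _. F lam) lam"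
      by (rule part_sum_cong) simp
    ultimately show "arrangements lam * F lam
        = arrangements lam * part_sum (\<lambda>k rho. F (add_mset k rho)) lam / size lam"
      by (simp add: part_sum_const)
  qed
  then show ?thesis using sum_first_part[OF assms] by simp
qed

lemma sum_split_first: "(\<Sum>k=1..Suc n. g k) = g 1 + (\<Sum>k=1..n. g (Suc k))"
  for g :: "nat \<Rightarrow> real"
  by (induction n) auto

text \<open>
  Pascal's rule: the last unit of a composition of \<open>n + 1\<close> either belongs to a longer part or is a
  part of its own, and removing it leaves a composition of \<open>n\<close>.
\<close>

lemma sum_compositions_Suc:
  assumes "1 \<le> n"
  shows "(\<Sum>lam\<in>partitions (Suc n). arrangements lam * h (size lam))
       = (\<Sum>lam\<in>partitions n. arrangements lam * h (size lam))
       + (\<Sum>lam\<in>partitions n. arrangements lam * h (Suc (size lam)))"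
proof -
  note peel = sum_peel_part[where F = "\<lambda>lam. h (size lam)", unfolded size_add_mset, symmetric]
  show ?thesis
    unfolding peel[OF assms] peel[of "Suc n", OF le_SucI[OF assms]] sum_split_first by simp
qed

section \<open>Moments of the number of parts\<close>

text \<open>
  The probability of a fixed composition of \<open>n\<close> into \<open>N\<close> parts: \<open>N - 1\<close> of the \<open>n - 1\<close> interior
  points are cut, the other \<open>n - N\<close> are not.
\<close>

definition cut_weight :: "real \<Rightarrow> nat \<Rightarrow> nat \<Rightarrow> real" where
  "cut_weight \<mu> n N = \<mu> ^ (N - 1) * (1 - \<mu>) ^ (n - N)"

definition parts_moment :: "real \<Rightarrow> nat \<Rightarrow> (nat \<Rightarrow> real) \<Rightarrow> real" where
  "parts_moment \<mu> n a = (\<Sum>lam\<in>partitions n. arrangements lam * (cut_weight \<mu> n (size lam) * a (size lam)))"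

lemma cut_weight_stretch: "N \<le> n \<Longrightarrow> cut_weight \<mu> (n + m) N = (1 - \<mu>) ^ m * cut_weight \<mu> n N"
proof -
  assume "N \<le> n"
  then have "n + m - N = m + (n - N)" by simp
  then show ?thesis by (simp add: cut_weight_def power_add)
qed

lemma cut_weight_cut: "1 \<le> N \<Longrightarrow> cut_weight \<mu> (Suc n) (Suc N) = \<mu> * cut_weight \<mu> n N"
  by (cases N) (simp_all add: cut_weight_def)

text \<open>
  One more interior point adds one part with probability \<open>\<mu>\<close>. Hence the number of parts is one
  plus a binomial variable, and its moments follow by induction on \<open>n\<close>.
\<close>

lemma parts_moment_Suc:
  assumes "1 \<le> n"
  shows "parts_moment \<mu> (Suc n) a = (1 - \<mu>) * parts_moment \<mu> n a + \<mu> * parts_moment \<mu> n (\<lambda>N. a (Suc N))"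
proof -
  have "1 \<le> size lam" "size lam \<le> n" if "lam \<in> partitions n" for lam
    using size_bounds[OF that assms] .
  then show ?thesis
    unfolding parts_moment_def sum_compositions_Suc[OF assms, where h = "\<lambda>N. cut_weight \<mu> (Suc n) N * a N"]
    by (auto simp: sum_distrib_left cut_weight_cut cut_weight_stretch[where m = 1, simplified] mult_ac
          intro!: sum.cong arg_cong2[where f = "(+)"])
qed

lemma partitions_1: "partitions 1 = {{#1#}}"
proof -
  have "lam = {#1#}" if "lam \<in> partitions 1" for lam
  proof -
    have "size lam = 1" using size_le_of_partition[OF that] partition_nonempty[OF that]
      by (simp add: le_Suc_eq)
    then obtain k where "lam = {#k#}" using size_1_singleton_mset by blast
    then show ?thesis using that by (simp add: partitions_def)
  qed
  then show ?thesis by (auto simp: partitions_def)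
qed

lemma parts_moment_1: "parts_moment \<mu> 1 a = a 1"
  using arrangements_remove[of 1 "{#1#}"]
  unfolding parts_moment_def partitions_1 by (simp add: cut_weight_def)

lemma parts_moment_lincomb:
  "parts_moment \<mu> n (\<lambda>N. b * a N + c * a' N) = b * parts_moment \<mu> n a + c * parts_moment \<mu> n a'"
  unfolding parts_moment_def by (simp add: sum_distrib_left sum.distrib[symmetric] algebra_simps)

lemma parts_moment_const: "1 \<le> n \<Longrightarrow> parts_moment \<mu> n (\<lambda>_. 1) = 1"
  by (induction n rule: nat_induct_at_least) (simp_all add: parts_moment_1[simplified] parts_moment_Suc)

lemma parts_moment_mean: "1 \<le> n \<Longrightarrow> parts_moment \<mu> n real = 1 + (real n - 1) * \<mu>"
proof (induction n rule: nat_induct_at_least)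
  case base
  then show ?case by (simp add: parts_moment_1[simplified])
next
  case (Suc n)
  have "parts_moment \<mu> n (\<lambda>N. real (Suc N)) = parts_moment \<mu> n real + 1"
    using parts_moment_lincomb[of \<mu> n 1 real 1 "\<lambda>_. 1"] parts_moment_const[OF Suc.hyps]
    by (simp add: add.commute)
  with Suc show ?case by (simp add: parts_moment_Suc algebra_simps)
qed

lemma parts_moment_pairs:
  "1 \<le> n \<Longrightarrow> parts_moment \<mu> n (\<lambda>N. real N * (real N - 1))
     = 2 * (real n - 1) * \<mu> + (real n - 1) * (real n - 2) * \<mu>\<^sup>2"
proof (induction n rule: nat_induct_at_least)
  case base
  then show ?case by (simp add: parts_moment_1[simplified])
next
  case (Suc n)
  have "parts_moment \<mu> n (\<lambda>N. real (Suc N) * (real (Suc N) - 1))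
      = parts_moment \<mu> n (\<lambda>N. real N * (real N - 1)) + 2 * parts_moment \<mu> n real"
    using parts_moment_lincomb[of \<mu> n 1 "\<lambda>N. real N * (real N - 1)" 2 real]
    by (simp add: algebra_simps)
  also have "\<dots> = 2 * (real n - 1) * \<mu> + (real n - 1) * (real n - 2) * \<mu>\<^sup>2
      + 2 * (1 + (real n - 1) * \<mu>)"
    unfolding Suc.IH parts_moment_mean[OF Suc.hyps] ..
  finally have step: "parts_moment \<mu> n (\<lambda>N. real (Suc N) * (real (Suc N) - 1)) = \<dots>" .
  show ?case
    unfolding parts_moment_Suc[OF Suc.hyps] Suc.IH step by (simp add: algebra_simps power2_eq_square)
qed

section \<open>The law of the parts of a random composition\<close>

text \<open>
  Forgetting whether the last interior point is cut.
\<close>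

lemma cut_weight_marginal:
  "1 \<le> N \<Longrightarrow> N \<le> n \<Longrightarrow> cut_weight \<mu> (Suc n) N + cut_weight \<mu> (Suc n) (Suc N) = cut_weight \<mu> n N"
  using cut_weight_stretch[of N n \<mu> 1] by (simp add: cut_weight_cut algebra_simps)

definition partition_law :: "real \<Rightarrow> nat \<Rightarrow> nat multiset pmf" where
  "partition_law \<mu> n = embed_pmf
     (\<lambda>lam. if lam \<in> partitions n then arrangements lam * cut_weight \<mu> n (size lam) else 0)"

lemma pmf_partition_law:
  assumes "0 \<le> \<mu>" "\<mu> \<le> 1" "1 \<le> n"
  shows "pmf (partition_law \<mu> n) lam =
    (if lam \<in> partitions n then arrangements lam * cut_weight \<mu> n (size lam) else 0)"
  unfolding partition_law_def
proof (rule pmf_embed_pmf)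
  let ?f = "\<lambda>lam. if lam \<in> partitions n then arrangements lam * cut_weight \<mu> n (size lam) else 0"
  show nonneg: "0 \<le> ?f lam" for lam
    using assms by (simp add: arrangements_nonneg cut_weight_def)
  have "(\<integral>\<^sup>+ lam. ennreal (?f lam) \<partial>count_space UNIV) = (\<Sum>lam\<in>partitions n. ennreal (?f lam))"
    by (rule nn_integral_count_space') (auto simp: finite_partitions)
  also have "\<dots> = ennreal (\<Sum>lam\<in>partitions n. ?f lam)"
    by (rule sum_ennreal) (rule nonneg)
  also have "(\<Sum>lam\<in>partitions n. ?f lam) = parts_moment \<mu> n (\<lambda>_. 1)"
    unfolding parts_moment_def by (intro sum.cong) auto
  finally show "(\<integral>\<^sup>+ lam. ennreal (?f lam) \<partial>count_space UNIV) = 1"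
    using parts_moment_const[OF assms(3)] by simp
qed

lemma set_partition_law:
  assumes "0 \<le> \<mu>" "\<mu> \<le> 1" "1 \<le> n"
  shows "set_pmf (partition_law \<mu> n) \<subseteq> partitions n"
  using pmf_partition_law[OF assms] by (auto simp: set_pmf_iff split: if_splits)

lemma expectation_partition_law:
  fixes \<phi> :: "nat multiset \<Rightarrow> real"
  assumes "0 \<le> \<mu>" "\<mu> \<le> 1" "1 \<le> n"
  shows "measure_pmf.expectation (partition_law \<mu> n) \<phi>
     = (\<Sum>lam\<in>partitions n. arrangements lam * (cut_weight \<mu> n (size lam) * \<phi> lam))"
  using set_partition_law[OF assms]
  by (subst integral_measure_pmf_real[OF finite_partitions[of n]])
     (auto simp: pmf_partition_law[OF assms] mult_ac intro!: sum.cong)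

section \<open>Stationarity under the up-and-down step\<close>

lemma expectation_random_part:
  fixes \<phi> :: "'a \<Rightarrow> real"
  assumes "lam \<noteq> {#}"
  shows "measure_pmf.expectation (map_pmf F (pmf_of_multiset lam)) \<phi>
     = (\<Sum>k\<in>set_mset lam. real (count lam k) * \<phi> (F k)) / size lam"
  unfolding integral_map_pmf sum_divide_distrib
  by (subst integral_measure_pmf_real[of "set_mset lam"])
     (auto simp: assms intro!: sum.cong)

lemma expectation_derow:
  fixes \<phi> :: "nat multiset \<Rightarrow> real"
  assumes "lam \<noteq> {#}"
  shows "measure_pmf.expectation (derow lam) \<phi>
     = part_sum (\<lambda>k rho. \<phi> (if k = 1 then rho else add_mset (k - 1) rho)) lam / size lam"
  unfolding derow_def expectation_random_part[OF assms] part_sum_def ..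

lemma expectation_row_up:
  fixes \<phi> :: "nat multiset \<Rightarrow> real"
  assumes "0 \<le> \<mu>" "\<mu> \<le> 1" "lam \<noteq> {#}"
  shows "measure_pmf.expectation (row_up \<mu> lam) \<phi>
     = \<mu> * \<phi> (add_mset 1 lam)
       + (1 - \<mu>) * (part_sum (\<lambda>k rho. \<phi> (add_mset (k + 1) rho)) lam / size lam)"
proof -
  have "measure_pmf.expectation (map_pmf (\<lambda>k. add_mset (k + 1) (lam - {#k#})) (pmf_of_multiset lam)) \<phi>
      = part_sum (\<lambda>k rho. \<phi> (add_mset (k + 1) rho)) lam / size lam"
    unfolding expectation_random_part[OF assms(3)] part_sum_def ..
  then show ?thesis
    unfolding row_up_def using assms
    by (subst pmf_expectation_bind[of UNIV]) (auto simp: UNIV_bool simp del: integral_map_pmf)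
qed

lemma pmf_eqI_expectation:
  assumes "\<And>\<phi> :: 'a \<Rightarrow> real. measure_pmf.expectation p \<phi> = measure_pmf.expectation q \<phi>"
  shows "p = q"
proof (rule pmf_eqI)
  fix x show "pmf p x = pmf q x"
    using assms[of "indicator {x}"] by (simp add: pmf.rep_eq)
qed

text \<open>
  The chosen row and the remaining rows are distributed as in \<open>sum_first_part\<close>. If the row has
  length one, a composition with one part fewer remains; otherwise shortening it is a bijection
  onto the compositions of \<open>n\<close> with the same number of parts. So a composition of \<open>n\<close> into \<open>N\<close>
  parts receives the weights of \<open>N\<close> and of \<open>N + 1\<close> parts, which add up by \<open>cut_weight_marginal\<close>.
\<close>

lemma derow_partition_law:
  assumes \<mu>: "0 \<le> \<mu>" "\<mu> \<le> 1" and n: "1 \<le> n"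
  shows "bind_pmf (partition_law \<mu> (Suc n)) derow = partition_law \<mu> n"
proof (rule pmf_eqI_expectation)
  fix \<phi> :: "nat multiset \<Rightarrow> real"
  let ?w = "\<lambda>lam. cut_weight \<mu> (Suc n) (size lam)"
  let ?f = "\<lambda>k rho. cut_weight \<mu> (Suc n) (Suc (size rho)) * \<phi> (if k = 1 then rho else add_mset (k - 1) rho)"
  have Sn: "1 \<le> Suc n" by simp
  have fin: "finite (set_pmf (derow lam))" if "lam \<in> partitions (Suc n)" for lam
    using partition_nonempty[OF that Sn] by (simp add: derow_def)
  have "measure_pmf.expectation (bind_pmf (partition_law \<mu> (Suc n)) derow) \<phi>
      = (\<Sum>lam\<in>partitions (Suc n). arrangements lam * part_sum ?f lam / size lam)"
  proof (subst pmf_expectation_bind[OF finite_partitions fin set_partition_law[OF \<mu> Sn]],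
         assumption, intro sum.cong refl)
    fix lam assume lam: "lam \<in> partitions (Suc n)"
    have "part_sum ?f lam
        = ?w lam * part_sum (\<lambda>k rho. \<phi> (if k = 1 then rho else add_mset (k - 1) rho)) lam"
      unfolding part_sum_def sum_distrib_left
      by (intro sum.cong refl) (simp only: size_Suc_Diff1 mult_ac)
    then show "pmf (partition_law \<mu> (Suc n)) lam *\<^sub>R measure_pmf.expectation (derow lam) \<phi>
        = arrangements lam * part_sum ?f lam / size lam"
      using lam by (simp add: pmf_partition_law[OF \<mu> Sn] expectation_derow[OF partition_nonempty[OF lam Sn]])
  qed
  also have "\<dots> = (\<Sum>k=1..Suc n. \<Sum>rho\<in>partitions (Suc n - k). arrangements rho * ?f k rho)"
    by (rule sum_first_part) simp
  \<comment> \<open>A chosen row of length one disappears; all longer ones are shifted down by one.\<close>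
  also have "\<dots> = (\<Sum>rho\<in>partitions n. arrangements rho * ?f 1 rho)
      + (\<Sum>k=1..n. \<Sum>rho\<in>partitions (n - k). arrangements rho * (?w (add_mset k rho) * \<phi> (add_mset k rho)))"
    unfolding sum_split_first by (intro arg_cong2[where f = "(+)"] sum.cong refl) auto
  also have "\<dots> = (\<Sum>rho\<in>partitions n. arrangements rho * ?f 1 rho)
      + (\<Sum>rho\<in>partitions n. arrangements rho * (?w rho * \<phi> rho))"
    by (subst sum_peel_part[OF n, where F = "\<lambda>lam. ?w lam * \<phi> lam"]) (rule refl)
  also have "\<dots> = (\<Sum>rho\<in>partitions n. arrangements rho * (cut_weight \<mu> n (size rho) * \<phi> rho))"
    unfolding sum.distrib[symmetric]
    by (intro sum.cong refl) (simp add: cut_weight_marginal[OF size_bounds[OF _ n], symmetric] algebra_simps)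
  finally show "measure_pmf.expectation (bind_pmf (partition_law \<mu> (Suc n)) derow) \<phi>
      = measure_pmf.expectation (partition_law \<mu> n) \<phi>"
    by (simp add: expectation_partition_law[OF \<mu> n])
qed

text \<open>
  A composition of \<open>n + 1\<close> whose first part is one arises by inserting a new part, with a factor \<open>\<mu>\<close>
  that is the price of the new cut; one with a longer first part arises by lengthening, with a
  factor \<open>1 - \<mu>\<close> for the new uncut point. The two cases together are \<open>sum_peel_part\<close> for
  \<open>n + 1\<close>.
\<close>

lemma row_up_partition_law:
  assumes \<mu>: "0 \<le> \<mu>" "\<mu> \<le> 1" and n: "1 \<le> n"
  shows "bind_pmf (partition_law \<mu> n) (row_up \<mu>) = partition_law \<mu> (Suc n)"
proof (rule pmf_eqI_expectation)
  fix \<phi> :: "nat multiset \<Rightarrow> real"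
  let ?F = "\<lambda>lam. cut_weight \<mu> (Suc n) (size lam) * \<phi> lam"
  have Sn: "1 \<le> Suc n" by simp
  have fin: "finite (set_pmf (row_up \<mu> lam))" if "lam \<in> partitions n" for lam
    using partition_nonempty[OF that n] by (auto simp: row_up_def)
  have "measure_pmf.expectation (bind_pmf (partition_law \<mu> n) (row_up \<mu>)) \<phi>
      = (\<Sum>lam\<in>partitions n. arrangements lam * ?F (add_mset 1 lam)
           + arrangements lam * part_sum (\<lambda>k rho. ?F (add_mset (Suc k) rho)) lam / size lam)"
  proof (subst pmf_expectation_bind[OF finite_partitions fin set_partition_law[OF \<mu> n]],
         assumption, intro sum.cong refl)
    fix lam assume lam: "lam \<in> partitions n"
    have size: "size lam \<le> n" "1 \<le> size lam" using size_bounds[OF lam n] by auto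
    have stretch: "cut_weight \<mu> (Suc n) (size lam) = (1 - \<mu>) * cut_weight \<mu> n (size lam)"
      using cut_weight_stretch[OF size(1), of \<mu> 1] by simp
    have eq: "part_sum (\<lambda>k rho. ?F (add_mset (Suc k) rho)) lam
        = (1 - \<mu>) * cut_weight \<mu> n (size lam) * part_sum (\<lambda>k rho. \<phi> (add_mset (Suc k) rho)) lam"
      unfolding part_sum_def sum_distrib_left
      by (intro sum.cong refl) (simp only: size_Suc_Diff1 size_add_mset stretch mult_ac)
    show "pmf (partition_law \<mu> n) lam *\<^sub>R measure_pmf.expectation (row_up \<mu> lam) \<phi>
        = arrangements lam * ?F (add_mset 1 lam)
           + arrangements lam * part_sum (\<lambda>k rho. ?F (add_mset (Suc k) rho)) lam / size lam"
      unfolding eq using lam size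
      by (simp add: pmf_partition_law[OF \<mu> n] expectation_row_up[OF \<mu> partition_nonempty[OF lam n]]
            cut_weight_cut algebra_simps)
  qed
  also have "\<dots> = (\<Sum>k=1..Suc n. \<Sum>rho\<in>partitions (Suc n - k). arrangements rho * ?F (add_mset k rho))"
    unfolding sum_split_first sum.distrib by (simp add: sum_first_part[OF n])
  also have "\<dots> = (\<Sum>lam\<in>partitions (Suc n). arrangements lam * ?F lam)"
    by (rule sum_peel_part) simp
  finally show "measure_pmf.expectation (bind_pmf (partition_law \<mu> n) (row_up \<mu>)) \<phi>
      = measure_pmf.expectation (partition_law \<mu> (Suc n)) \<phi>"
    by (simp add: expectation_partition_law[OF \<mu> Sn])
qed

lemma partition_law_stationary:
  assumes "0 \<le> \<mu>" "\<mu> \<le> 1" "2 \<le> n"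
  shows "is_stationary (partitions n) (derow_row \<mu>) (partition_law \<mu> n)"
proof -
  obtain m where m: "n = Suc m" "1 \<le> m" using assms(3) by (cases n) auto
  have "bind_pmf (partition_law \<mu> n) (derow_row \<mu>) = partition_law \<mu> n"
    unfolding derow_row_def bind_assoc_pmf[symmetric] m(1)
      derow_partition_law[OF assms(1,2) m(2)] row_up_partition_law[OF assms(1,2) m(2)] ..
  then show ?thesis
    using set_partition_law[OF assms(1,2), of n] assms(3) by (simp add: is_stationary_def)
qed

section \<open>Moments of the number of long parts\<close>

definition parts_above :: "nat \<Rightarrow> nat multiset \<Rightarrow> real" where
  "parts_above m lam = real (size {#k \<in># lam. k > m#})"

lemma parts_above_remove:
  "k \<in># lam \<Longrightarrow> parts_above m (lam - {#k#}) = parts_above m lam - (if k > m then 1 else 0)"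
  by (auto simp: parts_above_def dest!: multi_member_split)

lemma parts_above_eq_part_sum:
  "parts_above m lam = part_sum (\<lambda>k _. if k > m then 1 else 0) lam"
proof -
  have "real (size {#k \<in># lam. k > m#}) = (\<Sum>k\<in>set_mset {#k \<in># lam. k > m#}. real (count lam k))"
    by (simp add: size_multiset_overloaded_eq)
  also have "\<dots> = (\<Sum>k\<in>set_mset lam. real (count lam k) * (if k > m then 1 else 0))"
    by (rule sum.mono_neutral_cong_left) auto
  finally show ?thesis by (simp add: parts_above_def part_sum_def)
qed

lemma sum_parts_above:
  "(\<Sum>lam\<in>partitions n. arrangements lam * (F (size lam) * parts_above m lam))
   = (\<Sum>lam\<in>partitions (n - m). arrangements lam * (F (size lam) * size lam))"
proof -
  have "F (size lam) * parts_above m lam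
      = part_sum (\<lambda>k rho. if k > m then F (Suc (size rho)) else 0) lam" for lam
    unfolding parts_above_eq_part_sum part_sum_def sum_distrib_left
    by (intro sum.cong refl) (simp add: size_Suc_Diff1 del: size_Diff_singleton)
  moreover have "part_sum (\<lambda>_ rho. F (Suc (size rho))) lam = F (size lam) * size lam" for lam
  proof -
    have "part_sum (\<lambda>_ rho. F (Suc (size rho))) lam = part_sum (\<lambda>_ _. F (size lam)) lam"
      by (rule part_sum_cong) (simp only: size_Suc_Diff1)
    then show ?thesis by (simp add: part_sum_const)
  qed
  \<comment> \<open>Only the marked part is shrunk, so a factor depending on the number of parts is kept.\<close>
  ultimately show ?thesis
    using sum_large_parts[where n = n and m = m and f = "\<lambda>rho. F (Suc (size rho))"] by simp
qed

text \<open>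
  An ordered pair of distinct parts above \<open>m\<close> is a marked part above \<open>m\<close> together with a second
  one among the remaining parts. Shrinking the first leaves a free choice of a part different from
  the second, which gives the factor \<open>size lam - 1\<close>; then the second part is shrunk by
  \<open>sum_parts_above\<close>.
\<close>

lemma sum_pairs_above:
  "(\<Sum>lam\<in>partitions n. arrangements lam * (F (size lam) * (parts_above m lam * (parts_above m lam - 1))))
   = (\<Sum>lam\<in>partitions (n - m - m). arrangements lam * (F (size lam) * (real (size lam) * (real (size lam) - 1))))"
proof -
  have "F (size lam) * (parts_above m lam * (parts_above m lam - 1))
      = part_sum (\<lambda>k rho. if k > m then F (Suc (size rho)) * parts_above m rho else 0) lam" for lam
  proof -
    have "part_sum (\<lambda>k rho. if k > m then F (Suc (size rho)) * parts_above m rho else 0) lam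
        = (\<Sum>k\<in>set_mset lam. F (size lam) * (parts_above m lam - 1) * (real (count lam k) * (if k > m then 1 else 0)))"
      unfolding part_sum_def
      by (intro sum.cong refl) (simp add: size_Suc_Diff1 parts_above_remove del: size_Diff_singleton)
    then show ?thesis
      unfolding sum_distrib_left[symmetric] part_sum_def[of "\<lambda>k _. if k > m then 1 else 0", symmetric]
        parts_above_eq_part_sum[symmetric] by simp
  qed
  moreover have "part_sum (\<lambda>_ rho. F (Suc (size rho)) * parts_above m rho) lam
      = (F (size lam) * (real (size lam) - 1)) * parts_above m lam" for lam
  proof -
    have "part_sum (\<lambda>_ rho. F (Suc (size rho)) * parts_above m rho) lam
        = (\<Sum>k\<in>set_mset lam. F (size lam) * (real (count lam k) * parts_above m lam
             - real (count lam k) * (if k > m then 1 else 0)))"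
      unfolding part_sum_def
      by (intro sum.cong refl) (simp add: size_Suc_Diff1 parts_above_remove algebra_simps del: size_Diff_singleton)
    also have "\<dots> = F (size lam) * (part_sum (\<lambda>_ _. parts_above m lam) lam - parts_above m lam)"
      unfolding sum_distrib_left[symmetric] sum_subtractf parts_above_eq_part_sum by (simp add: part_sum_def)
    finally show ?thesis by (simp add: part_sum_const algebra_simps)
  qed
  ultimately have "(\<Sum>lam\<in>partitions n. arrangements lam * (F (size lam) * (parts_above m lam * (parts_above m lam - 1))))
     = (\<Sum>lam\<in>partitions (n - m). arrangements lam * ((F (size lam) * (real (size lam) - 1)) * parts_above m lam))"
    using sum_large_parts[where n = n and m = m and f = "\<lambda>rho. F (Suc (size rho)) * parts_above m rho"] by simp
  then show ?thesis
    unfolding sum_parts_above[where F = "\<lambda>N. F N * (real N - 1)"] by (simp add: mult_ac)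
qed

text \<open>
  After shrinking, the weights still refer to \<open>n\<close>; the \<open>m\<close> units removed account for \<open>m\<close> uncut
  points.
\<close>

lemma stretched_moment:
  assumes "m \<le> n"
  shows "(\<Sum>lam\<in>partitions (n - m). arrangements lam * (cut_weight \<mu> n (size lam) * a (size lam)))
     = (1 - \<mu>) ^ m * parts_moment \<mu> (n - m) a"
  unfolding parts_moment_def sum_distrib_left
proof (intro sum.cong refl)
  fix lam assume "lam \<in> partitions (n - m)"
  then show "arrangements lam * (cut_weight \<mu> n (size lam) * a (size lam))
      = (1 - \<mu>) ^ m * (arrangements lam * (cut_weight \<mu> (n - m) (size lam) * a (size lam)))"
    using cut_weight_stretch[OF size_le_of_partition, of lam "n - m" \<mu> m] assms by simp
qed

lemma expectation_parts_above:
  assumes "0 \<le> \<mu>" "\<mu> \<le> 1" "m < n"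
  shows "measure_pmf.expectation (partition_law \<mu> n) (parts_above m)
     = (1 - \<mu>) ^ m * (1 + (real n - real m - 1) * \<mu>)"
  using assms
  by (simp add: expectation_partition_law sum_parts_above stretched_moment[where a = real]
      parts_moment_mean of_nat_diff)

lemma expectation_pairs_above:
  assumes "0 \<le> \<mu>" "\<mu> \<le> 1" "2 * m < n"
  shows "measure_pmf.expectation (partition_law \<mu> n) (\<lambda>lam. parts_above m lam * (parts_above m lam - 1))
     = (1 - \<mu>) ^ (2 * m) * (2 * (real n - 2 * real m - 1) * \<mu>
         + (real n - 2 * real m - 1) * (real n - 2 * real m - 2) * \<mu>\<^sup>2)"
proof -
  have "n - m - m = n - 2 * m" by simp
  then show ?thesis using assms
  by (simp add: expectation_partition_law sum_pairs_above
      stretched_moment[where a = "\<lambda>N. real N * (real N - 1)"] parts_moment_pairs of_nat_diff)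
qed

section \<open>Uniqueness of the stationary law\<close>

text \<open>
  The positive part \<open>D\<close> of \<open>p - q\<close> is pointwise at most its image under the chain. The chain
  preserves total mass, so \<open>D\<close> is in fact invariant, and the support of an invariant
  nonnegative measure is closed under possible steps.
\<close>

lemma stationary_excess_step:
  assumes S: "finite S" "\<And>x. x \<in> S \<Longrightarrow> set_pmf (K x) \<subseteq> S"
    and p: "is_stationary S K p" and q: "is_stationary S K q"
    and x: "x \<in> S" "pmf q x < pmf p x" and y: "y \<in> set_pmf (K x)"
  shows "pmf q y < pmf p y"
proof -
  define D where "D = (\<lambda>z. max 0 (pmf p z - pmf q z))"
  have balance: "pmf r z = (\<Sum>x\<in>S. pmf r x * pmf (K x) z)" if "is_stationary S K r" for r z
  proof -
    have "pmf r z = pmf (bind_pmf r K) z" using that by (simp add: is_stationary_def)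
    also have "\<dots> = (\<Sum>x\<in>S. pmf (K x) z * pmf r x)"
      unfolding pmf_bind using that S(1)
      by (intro integral_measure_pmf_real) (auto simp: is_stationary_def)
    finally show ?thesis by (simp add: mult.commute)
  qed
  have D_le: "D z \<le> (\<Sum>x\<in>S. D x * pmf (K x) z)" for z
  proof -
    have "pmf p z - pmf q z = (\<Sum>x\<in>S. (pmf p x - pmf q x) * pmf (K x) z)"
      unfolding balance[OF p, of z] balance[OF q, of z] by (simp add: sum_subtractf left_diff_distrib)
    also have "\<dots> \<le> (\<Sum>x\<in>S. D x * pmf (K x) z)"
      by (intro sum_mono mult_right_mono) (auto simp: D_def)
    finally show ?thesis
      by (auto simp: D_def intro: sum_nonneg)
  qed
  have "(\<Sum>z\<in>S. \<Sum>x\<in>S. D x * pmf (K x) z) = (\<Sum>x\<in>S. D x * (\<Sum>z\<in>S. pmf (K x) z))"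
    unfolding sum_distrib_left by (rule sum.swap)
  also have "\<dots> = (\<Sum>x\<in>S. D x)"
    by (intro sum.cong refl) (simp add: sum_pmf_eq_1 S)
  finally have "D y = (\<Sum>x\<in>S. D x * pmf (K x) y)"
    using sum_mono_inv[of D S "\<lambda>z. \<Sum>x\<in>S. D x * pmf (K x) z" y] D_le S x y by auto
  also have "\<dots> \<ge> D x * pmf (K x) y"
    using S(1) x(1) by (intro member_le_sum) (auto simp: D_def)
  finally have "D x * pmf (K x) y \<le> D y" .
  moreover have "0 < D x * pmf (K x) y"
    using x y by (simp add: D_def pmf_positive)
  ultimately show ?thesis by (auto simp: D_def max_def split: if_splits)
qed

text \<open>
  If two stationary laws differ, each exceeds the other somewhere because both have mass one. Both
  excesses then spread to the common state \<open>s\<close>, which is absurd.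
\<close>

lemma stationary_unique:
  assumes S: "finite S" "\<And>x. x \<in> S \<Longrightarrow> set_pmf (K x) \<subseteq> S"
    and reach: "\<And>x. x \<in> S \<Longrightarrow> (x, s) \<in> {(x, y). x \<in> S \<and> y \<in> set_pmf (K x)}\<^sup>*"
    and p: "is_stationary S K p" and q: "is_stationary S K q"
  shows "p = q"
proof -
  have excess: "pmf q s < pmf p s"
    if pq: "is_stationary S K p" "is_stationary S K q" and ne: "p \<noteq> q" for p q
  proof -
    have "\<exists>x\<in>S. pmf q x < pmf p x"
    proof (rule ccontr)
      assume "\<not> ?thesis"
      then have le: "pmf p x \<le> pmf q x" if "x \<in> S" for x using that by force
      have "sum (pmf p) S = sum (pmf q) S"
        using pq S(1) by (simp add: is_stationary_def sum_pmf_eq_1)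
      then have "pmf p x = pmf q x" if "x \<in> S" for x
        using sum_mono_inv[of "pmf p" S "pmf q"] le that S(1) by blast
      moreover have "pmf p x = pmf q x" if "x \<notin> S" for x
        using pq that by (metis is_stationary_def pmf_eq_0_set_pmf subsetD)
      ultimately show False using ne by (metis pmf_eqI)
    qed
    then obtain x where x: "x \<in> S" "pmf q x < pmf p x" by blast
    from reach[OF x(1)] show ?thesis
    proof (induction rule: rtrancl_induct)
      case base
      then show ?case by (rule x(2))
    next
      case (step y z)
      then show ?case using stationary_excess_step[OF S pq, of y z] by auto
    qed
  qed
  show ?thesis using excess[OF p q] excess[OF q p] by fastforce
qed

lemma set_derow:
  assumes "lam \<in> partitions n" "1 \<le> n"
  shows "set_pmf (derow lam)
    = (\<lambda>k. if k = 1 then lam - {#k#} else add_mset (k - 1) (lam - {#k#})) ` set_mset lam"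
  using partition_nonempty[OF assms] by (simp add: derow_def)

lemma set_row_up:
  assumes "0 < \<mu>" "\<mu> < 1" "nu \<in> partitions n" "1 \<le> n"
  shows "set_pmf (row_up \<mu> nu)
    = insert (add_mset 1 nu) ((\<lambda>k. add_mset (k + 1) (nu - {#k#})) ` set_mset nu)"
  using assms(1,2) partition_nonempty[OF assms(3,4)]
  by (auto simp: row_up_def set_pmf_bernoulli split: if_splits)

lemma derow_row_closed:
  assumes "0 < \<mu>" "\<mu> < 1" "2 \<le> n" "lam \<in> partitions n"
  shows "set_pmf (derow_row \<mu> lam) \<subseteq> partitions n"
proof -
  have down: "nu \<in> partitions (n - 1)" if "nu \<in> set_pmf (derow lam)" for nu
  proof -
    from that obtain k where k: "k \<in># lam"
      "nu = (if k = 1 then lam - {#k#} else add_mset (k - 1) (lam - {#k#}))"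
      using set_derow[OF assms(4)] assms(3) by auto
    have "1 \<le> k" "k \<le> n" "lam - {#k#} \<in> partitions (n - k)" using part_bounds[OF assms(4) k(1)] by auto
    then show ?thesis
      using add_part[of "k - 1" "n - 1" "lam - {#k#}"] k(2) by auto
  qed
  have up: "set_pmf (row_up \<mu> nu) \<subseteq> partitions n" if nu: "nu \<in> partitions (n - 1)" for nu
  proof -
    have "add_mset (k + 1) (nu - {#k#}) \<in> partitions n" if "k \<in># nu" for k
      using part_bounds[OF nu that] assms(3) by (intro add_part) auto
    moreover have "add_mset 1 nu \<in> partitions n" using nu assms(3) by (intro add_part) auto
    ultimately show ?thesis using set_row_up[OF assms(1,2) nu] assms(3) by auto
  qed
  show ?thesis unfolding derow_row_def using down up by auto
qed

text \<open>
  Shortening a part \<open>k \<ge> 2\<close> and then adding a new part raises the number of parts by one; this can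
  be repeated until all parts are one.
\<close>

lemma reach_all_ones:
  assumes "0 < \<mu>" "\<mu> < 1" "2 \<le> n" "lam \<in> partitions n"
  shows "(lam, replicate_mset n 1) \<in> {(x, y). x \<in> partitions n \<and> y \<in> set_pmf (derow_row \<mu> x)}\<^sup>*"
  using assms(4)
proof (induction "n - size lam" arbitrary: lam rule: less_induct)
  case less
  show ?case
  proof (cases "\<forall>k\<in>#lam. k = 1")
    case True
    then have lam: "lam = replicate_mset (size lam) 1"
      by (metis set_mset_subset_singletonD singletonI subsetI)
    then have "sum_mset lam = size lam" by (metis mult.right_neutral sum_mset_replicate_mset of_nat_id)
    then have "size lam = n" using less.prems by (simp add: partitions_def)
    then show ?thesis using lam by simp
  next
    case False
    then obtain k where k: "k \<in># lam" "k \<noteq> 1" by blast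
    define nu where "nu = add_mset (k - 1) (lam - {#k#})"
    note bounds = part_bounds[OF less.prems k(1)]
    have nu: "nu \<in> partitions (n - 1)"
      unfolding nu_def using bounds k(2) by (intro add_part) auto
    have "nu \<in> set_pmf (derow lam)"
      using set_derow[OF less.prems] assms(3) k unfolding nu_def by auto
    moreover have "add_mset 1 nu \<in> set_pmf (row_up \<mu> nu)"
      using set_row_up[OF assms(1,2) nu] assms(3) by simp
    ultimately have step: "add_mset 1 nu \<in> set_pmf (derow_row \<mu> lam)"
      unfolding derow_row_def by auto
    then have new: "add_mset 1 nu \<in> partitions n"
      using derow_row_closed[OF assms(1-3) less.prems] by blast
    have "size (add_mset 1 nu) = Suc (size lam)"
      using size_Suc_Diff1[OF k(1)] by (simp add: nu_def)
    then have "n - size (add_mset 1 nu) < n - size lam"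
      using size_le_of_partition[OF new] by simp
    from less.hyps[OF this new] show ?thesis
      using step less.prems by (auto intro: converse_rtrancl_into_rtrancl)
  qed
qed

lemma derow_row_stationary_eq:
  assumes "0 < \<mu>" "\<mu> < 1" "2 \<le> n"
  shows "derow_row_stationary n \<mu> = partition_law \<mu> n"
  unfolding derow_row_stationary_def
proof (rule the_equality)
  show st: "is_stationary (partitions n) (derow_row \<mu>) (partition_law \<mu> n)"
    using assms by (intro partition_law_stationary) auto
  fix p assume "is_stationary (partitions n) (derow_row \<mu>) p"
  then show "p = partition_law \<mu> n"
    using stationary_unique[OF finite_partitions derow_row_closed[OF assms] reach_all_ones[OF assms]] st
    by blast
qed

section \<open>The limit shape\<close>

lemma rescaled_boundary_eq:
  assumes "0 < \<mu>" "0 \<le> x"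
  shows "rescaled_boundary n (1 / \<mu>) lam x = parts_above (nat \<lfloor>x / \<mu>\<rfloor>) lam / (\<mu> * real n)"
proof -
  have "real k > 1 / \<mu> * x \<longleftrightarrow> k > nat \<lfloor>x / \<mu>\<rfloor>" for k
  proof -
    have "k > nat \<lfloor>x / \<mu>\<rfloor> \<longleftrightarrow> \<lfloor>x / \<mu>\<rfloor> < int k" using assms by (simp add: nat_less_iff)
    also have "\<dots> \<longleftrightarrow> x / \<mu> < real k" by (simp add: floor_less_iff)
    finally show ?thesis by simp
  qed
  then show ?thesis by (simp add: rescaled_boundary_def parts_above_def)
qed

text \<open>
  Chebyshev's inequality around a point \<open>c\<close> that need not be the mean, so that the limit can be
  inserted directly.
\<close>

lemma prob_near_ge:
  fixes f :: "'a \<Rightarrow> real"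
  assumes "finite (set_pmf p)" "set_pmf p \<subseteq> A" "0 < \<epsilon>"
  shows "1 - measure_pmf.expectation p (\<lambda>x. (f x - c)\<^sup>2) / \<epsilon>\<^sup>2
      \<le> measure_pmf.prob p {x \<in> A. \<bar>f x - c\<bar> < \<epsilon>}"
proof -
  have "measure_pmf.prob p {x \<in> space (measure_pmf p). \<epsilon>\<^sup>2 \<le> (f x - c)\<^sup>2}
      \<le> measure_pmf.expectation p (\<lambda>x. (f x - c)\<^sup>2) / \<epsilon>\<^sup>2"
    using assms by (intro integral_Markov_inequality_measure[where A = "{}"])
       (auto intro: integrable_measure_pmf_finite)
  moreover have "{x \<in> space (measure_pmf p). \<epsilon>\<^sup>2 \<le> (f x - c)\<^sup>2} = - {x. \<bar>f x - c\<bar> < \<epsilon>}"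
    using assms(3) by (auto simp: abs_le_square_iff[symmetric] not_less)
  moreover have "measure_pmf.prob p (- {x. \<bar>f x - c\<bar> < \<epsilon>}) = 1 - measure_pmf.prob p {x. \<bar>f x - c\<bar> < \<epsilon>}"
    by (simp add: measure_pmf.prob_compl[simplified] Compl_eq_Diff_UNIV)
  moreover have "measure_pmf.prob p {x. \<bar>f x - c\<bar> < \<epsilon>} = measure_pmf.prob p {x \<in> A. \<bar>f x - c\<bar> < \<epsilon>}"
    using assms(2) by (intro measure_pmf.finite_measure_eq_AE) (auto simp: AE_measure_pmf_iff)
  ultimately show ?thesis by simp
qed

text \<open>
  The second moment enters through \<open>f * (f - 1)\<close> because factorial moments are the ones that
  counting pairs delivers.
\<close>

lemma mean_square_deviation:
  fixes f :: "'a \<Rightarrow> real"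
  assumes "finite (set_pmf p)"
  shows "measure_pmf.expectation p (\<lambda>x. (f x / t - c)\<^sup>2)
     = (measure_pmf.expectation p (\<lambda>x. f x * (f x - 1)) / t\<^sup>2) + measure_pmf.expectation p f / t\<^sup>2
       - 2 * c * (measure_pmf.expectation p f / t) + c\<^sup>2"
proof -
  have [simp]: "integrable (measure_pmf p) g" for g :: "'a \<Rightarrow> real"
    using assms by (rule integrable_measure_pmf_finite)
  have "measure_pmf.expectation p (\<lambda>x. (f x / t - c)\<^sup>2)
     = measure_pmf.expectation p (\<lambda>x. (f x * (f x - 1)) / t\<^sup>2 + f x / t\<^sup>2 - 2 * c * (f x / t) + c\<^sup>2)"
    by (intro arg_cong[where f = "measure_pmf.expectation p"] ext)
       (cases "t = 0", auto simp: power2_eq_square field_simps)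
  then show ?thesis by simp
qed

lemma power_tendsto_exp:
  fixes \<mu> :: "nat \<Rightarrow> real" and m :: "nat \<Rightarrow> nat"
  assumes pos: "\<And>n. 0 < \<mu> n \<and> \<mu> n < 1" and lim: "\<mu> \<longlonglongrightarrow> 0" and m: "(\<lambda>n. m n * \<mu> n) \<longlonglongrightarrow> x"
  shows "(\<lambda>n. (1 - \<mu> n) ^ m n) \<longlonglongrightarrow> exp (- x)"
proof -
  have "((\<lambda>u::real. ln (1 - u) / u) \<longlongrightarrow> - 1) (at_right 0)" by real_asymp
  moreover have "\<mu> n \<noteq> 0" "\<mu> n \<in> {0<..}" for n using pos[of n] by auto
  then have "filterlim \<mu> (at_right 0) sequentially"
    using lim by (simp add: filterlim_at)
  ultimately have "(\<lambda>n. ln (1 - \<mu> n) / \<mu> n) \<longlonglongrightarrow> - 1" by (rule filterlim_compose)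
  from tendsto_mult[OF m this] have "(\<lambda>n. m n * \<mu> n * (ln (1 - \<mu> n) / \<mu> n)) \<longlonglongrightarrow> - x" by simp
  then have "(\<lambda>n. exp (m n * \<mu> n * (ln (1 - \<mu> n) / \<mu> n))) \<longlonglongrightarrow> exp (- x)" by (rule tendsto_exp)
  moreover have "exp (m n * \<mu> n * (ln (1 - \<mu> n) / \<mu> n)) = (1 - \<mu> n) ^ m n" for n
    using pos[of n] by (simp add: exp_of_nat_mult)
  ultimately show ?thesis by simp
qed

theorem corollary2:
  fixes \<mu> :: "nat \<Rightarrow> real"
  assumes "\<And>n. 0 < \<mu> n \<and> \<mu> n < 1"
    and "(\<lambda>n. \<mu> n * ln (\<mu> n * real n)) \<longlonglongrightarrow> 0"
    and "filterlim (\<lambda>n. \<mu> n * real n) at_top sequentially"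
  shows "has_limit_shape (\<lambda>n. derow_row_stationary n (\<mu> n)) (\<lambda>n. 1 / \<mu> n) (\<lambda>x. exp (- x))"
  unfolding has_limit_shape_def
proof (intro allI impI)
  fix x \<epsilon> :: real
  assume x: "0 < x" and \<epsilon>: "0 < \<epsilon>"
  define t where "t = (\<lambda>n. \<mu> n * real n)"
  define m where "m = (\<lambda>n. nat \<lfloor>x / \<mu> n\<rfloor>)"
  define c where "c = exp (- x)"
  have t: "filterlim t at_top sequentially" using assms(3) by (simp add: t_def)
  \<comment> \<open>Once the logarithm exceeds one, the hypothesis on its product with \<open>\<mu>\<close> dominates \<open>\<mu>\<close>.\<close>
  have \<mu>0: "\<mu> \<longlonglongrightarrow> 0"
  proof (rule Lim_null_comparison[OF _ assms(2)])
    have "eventually (\<lambda>n. exp 1 \<le> t n) sequentially" using t by (simp add: filterlim_at_top)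
    then show "\<forall>\<^sub>F n in sequentially. norm (\<mu> n) \<le> \<mu> n * ln (\<mu> n * real n)"
    proof eventually_elim
      case (elim n)
      then have "1 \<le> ln (\<mu> n * real n)"
        by (simp add: t_def ln_ge_iff less_le_trans[OF exp_gt_zero])
      then show ?case using assms(1)[of n] by simp
    qed
  qed
  have m_bounds: "m n * \<mu> n \<le> x" "x - \<mu> n \<le> m n * \<mu> n" for n
  proof -
    have "real (m n) \<le> x / \<mu> n" "x / \<mu> n - 1 \<le> real (m n)"
      using x assms(1)[of n] by (auto simp: m_def intro: less_imp_le)
    then show "m n * \<mu> n \<le> x" "x - \<mu> n \<le> m n * \<mu> n"
      using assms(1)[of n] by (auto simp: field_simps)
  qed
  have m\<mu>: "(\<lambda>n. m n * \<mu> n) \<longlonglongrightarrow> x"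
    by (rule tendsto_sandwich[of "\<lambda>n. x - \<mu> n" _ _ "\<lambda>_. x"])
       (use m_bounds tendsto_diff[OF tendsto_const \<mu>0, of x] in auto)
  have power: "(\<lambda>n. (1 - \<mu> n) ^ m n) \<longlonglongrightarrow> c"
    unfolding c_def by (rule power_tendsto_exp[OF assms(1) \<mu>0 m\<mu>])
  have inv: "(\<lambda>n. 1 / t n) \<longlonglongrightarrow> 0"
    using tendsto_inverse_0_at_top[OF t] by (simp add: inverse_eq_divide)
  \<comment> \<open>\<open>E1\<close> and \<open>E2\<close> are the first two factorial moments of the number of parts above \<open>m\<close>, divided by \<open>t\<close> and \<open>t\<^sup>2\<close> and written in \<open>m * \<mu>\<close>, \<open>1 / t\<close> and \<open>\<mu>\<close>, whose limits are known.\<close>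
  define E1 where "E1 = (\<lambda>n. (1 - \<mu> n) ^ m n * (1 / t n + (1 - m n * \<mu> n * (1 / t n) - \<mu> n * (1 / t n))))"
  define E2 where "E2 = (\<lambda>n. ((1 - \<mu> n) ^ m n)\<^sup>2 *
     (2 * (1 - 2 * (m n * \<mu> n) * (1 / t n) - \<mu> n * (1 / t n)) * (1 / t n)
      + (1 - 2 * (m n * \<mu> n) * (1 / t n) - \<mu> n * (1 / t n)) * (1 - 2 * (m n * \<mu> n) * (1 / t n) - 2 * \<mu> n * (1 / t n))))"
  have "E1 \<longlonglongrightarrow> c * (0 + (1 - x * 0 - 0 * 0))"
    unfolding E1_def by (intro tendsto_intros power inv m\<mu> \<mu>0)
  then have E1: "E1 \<longlonglongrightarrow> c" by simp
  have "E2 \<longlonglongrightarrow> c\<^sup>2 * (2 * (1 - 2 * x * 0 - 0 * 0) * 0 + (1 - 2 * x * 0 - 0 * 0) * (1 - 2 * x * 0 - 2 * 0 * 0))"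
    unfolding E2_def by (intro tendsto_intros power inv m\<mu> \<mu>0)
  then have E2: "E2 \<longlonglongrightarrow> c\<^sup>2" by simp
  have "(\<lambda>n. 1 - (E2 n + E1 n * (1 / t n) - 2 * c * E1 n + c\<^sup>2) / \<epsilon>\<^sup>2)
      \<longlonglongrightarrow> 1 - (c\<^sup>2 + c * 0 - 2 * c * c + c\<^sup>2) / \<epsilon>\<^sup>2"
    by (intro tendsto_intros E1 E2 inv) (use \<epsilon> in simp)
  then have lower: "(\<lambda>n. 1 - (E2 n + E1 n * (1 / t n) - 2 * c * E1 n + c\<^sup>2) / \<epsilon>\<^sup>2) \<longlonglongrightarrow> 1"
    by (simp add: power2_eq_square)
  \<comment> \<open>The second condition ensures \<open>2 * m < n\<close>, as needed for the factorial moment of order two.\<close>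
  have large: "\<forall>\<^sub>F n in sequentially. 2 \<le> n \<and> 2 * x + 1 \<le> t n"
    using t by (intro eventually_conj eventually_ge_at_top) (simp add: filterlim_at_top)
  have bound: "\<forall>\<^sub>F n in sequentially. 1 - (E2 n + E1 n * (1 / t n) - 2 * c * E1 n + c\<^sup>2) / \<epsilon>\<^sup>2
      \<le> measure_pmf.prob (derow_row_stationary n (\<mu> n))
           {lam \<in> partitions n. \<bar>rescaled_boundary n (1 / \<mu> n) lam x - exp (- x)\<bar> < \<epsilon>}"
    using large
  proof eventually_elim
    case (elim n)
    have \<mu>: "0 < \<mu> n" "\<mu> n < 1" "0 \<le> \<mu> n" "\<mu> n \<le> 1" and n: "2 \<le> n" "1 \<le> n" "0 < real n" and tn: "0 < t n"
      using assms(1)[of n] elim x by auto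
    let ?p = "partition_law (\<mu> n) n"
    have sub: "set_pmf ?p \<subseteq> partitions n" by (rule set_partition_law) (use \<mu> n in auto)
    then have fin: "finite (set_pmf ?p)" using finite_partitions finite_subset by blast
    have "2 * real (m n) * \<mu> n < real n * \<mu> n"
      using m_bounds(1)[of n] elim x by (simp add: t_def mult.commute)
    then have "real (2 * m n) < real n" using \<mu> by simp
    then have mn: "2 * m n < n" "m n < n" by linarith+
    have mean: "measure_pmf.expectation ?p (parts_above (m n)) / t n = E1 n"
      unfolding expectation_parts_above[OF \<mu>(3,4) mn(2)] E1_def t_def
      using \<mu> n by (simp add: field_simps)
    have pairs: "measure_pmf.expectation ?p (\<lambda>lam. parts_above (m n) lam * (parts_above (m n) lam - 1)) / (t n)\<^sup>2 = E2 n"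
      unfolding expectation_pairs_above[OF \<mu>(3,4) mn(1)] E2_def t_def
      using \<mu> n by (simp add: field_simps power2_eq_square power_mult)
    have "measure_pmf.expectation ?p (\<lambda>lam. (parts_above (m n) lam / t n - c)\<^sup>2)
        = E2 n + E1 n * (1 / t n) - 2 * c * E1 n + c\<^sup>2"
      unfolding mean_square_deviation[OF fin] pairs mean
      unfolding mean[symmetric] by (simp add: power2_eq_square)
    then show ?case
      using prob_near_ge[OF fin sub \<epsilon>, of "\<lambda>lam. parts_above (m n) lam / t n" c]
      by (simp add: derow_row_stationary_eq[OF \<mu>(1,2) n(1)] rescaled_boundary_eq[OF \<mu>(1) less_imp_le[OF x]]
            m_def t_def c_def)
  qed
  show "(\<lambda>n. measure_pmf.prob (derow_row_stationary n (\<mu> n))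
           {lam \<in> partitions n. \<bar>rescaled_boundary n (1 / \<mu> n) lam x - exp (- x)\<bar> < \<epsilon>}) \<longlonglongrightarrow> 1"
    by (rule tendsto_sandwich[OF bound _ lower tendsto_const]) (simp add: measure_pmf.prob_le_1)
qed

end
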